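(* Let $\mathcal{K}=(S,AP,\mathcal{L},\to)$ be a weighted Kripke structure and $d$ its weighted branching simulation distance. For all states $s,t\in S$ and all $\varepsilon\in\mathbb{R}_{\ge 0}$: \[ d(s,t)\le\varepsilon \quad\text{iff}\quad s\le_{\varepsilon} t . \]
   Context: A weighted Kripke structure (WKS) is a tuple $\mathcal{K}=(S,AP,\mathcal{L},\to)$ where $S$ is a finite set of states, $AP$ a set of atomic propositions, $\mathcal{L}:S\to\mathcal{P}(AP)$ a labelling function, and $\to\subseteq S\times\mathbb{Q}_{\ge 0}\times S$ a finite transition relation; we write $s\to_w s'$ for $(s,w,s')\in\to$. A transition sequence from $t$ of length $n\ge 0$ is $t=t_0\to_{v_1}t_1\cdots\to_{v_n}t_n$ with accumulated weight $\sum_{i=1}^n v_i$ ($0$ for $n=0$). Weighted branching $\varepsilon$-simulation: for $\varepsilon\in\mathbb{R}_{\ge 0}$, a relation $R\subseteq S\times S$ is a weighted branching $\varepsilon$-simulation if whenever $(s,t)\in R$: $\mathcal{L}(s)=\mathcal{L}(t)$, and for every $s\to_w s'$ there is a transition sequence $t\to_{v_1}t_1\cdots\to_{v_k}t_k$ with $\sum_{i=1}^k v_i\in[w(1-\varepsilon),w(1+\varepsilon)]$, $(s',t_k)\in R$, and $(s,t_i)\in R$ for all $i<k$. We write $s\le_\varepsilon t$ if some weighted branching $\varepsilon$-simulation contains $(s,t)$. Distance: functions $d:S\times S\to[0,\infty]$ are ordered pointwise (a complete lattice). Define $\mathcal{F}$ by $\mathcal{F}(d)(s,t)=\infty$ if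 $\mathcal{L}(s)\neq\mathcal{L}(t)$, and otherwise \[ \mathcal{F}(d)(s,t)=\max_{s\to_w s'}\ \min_{t\to_{v_1}t_1\cdots\to_{v_n}t_n}\max\Big\{\Big|\tfrac{\sum_{i=1}^n v_i}{w}-1\Big|,\ d(s',t_n),\ \max\{d(s,t_i)\mid 1\le i<n\}\Big\}, \] where the outer max ranges over transitions of $s$, the inner min over all (possibly infinitely many) transition sequences from $t$ (understood as an infimum), and the max of an empty set is $0$. $\mathcal{F}$ is monotone; the weighted branching simulation distance $d$ is its least fixed point.
   Formalization: For transitions of weight w = 0, where the quotient in the definition of the distance is undefined, the term |Σv_i/w − 1| is taken to be 0 if Σv_i = 0 and ∞ otherwise. *)

theory Defs
  imports "HOL-Library.Extended_Nonnegative_Real"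
begin

record ('s, 'p) wks =
  states :: "'s set"
  props  :: "'p set"
  label  :: "'s \<Rightarrow> 'p set"
  trans  :: "('s \<times> rat \<times> 's) set"

definition weighted_kripke_structure :: "('s, 'p) wks \<Rightarrow> bool" where
  "weighted_kripke_structure K \<longleftrightarrow>
     finite (states K) \<and>
     (\<forall>s\<in>states K. label K s \<subseteq> props K) \<and>
     finite (trans K) \<and>
     trans K \<subseteq> states K \<times> {w. 0 \<le> w} \<times> states K"

text \<open>
  The transition sequence \<open>t = t\<^sub>0 \<rightarrow> t\<^sub>1 \<rightarrow> \<dots> \<rightarrow> t\<^sub>n\<close> with weights \<open>v\<^sub>1, \<dots>, v\<^sub>n\<close>
  is represented by its start \<open>t\<close> together with the list \<open>[(v\<^sub>1, t\<^sub>1), \<dots>, (v\<^sub>n, t\<^sub>n)]\<close>;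
  the empty list is the sequence of length 0.
\<close>

fun trans_seq :: "('s, 'p) wks \<Rightarrow> 's \<Rightarrow> (rat \<times> 's) list \<Rightarrow> bool" where
  "trans_seq K t [] \<longleftrightarrow> True"
| "trans_seq K t ((v, t') # \<pi>) \<longleftrightarrow> (t, v, t') \<in> trans K \<and> trans_seq K t' \<pi>"

definition seq_state :: "'s \<Rightarrow> (rat \<times> 's) list \<Rightarrow> nat \<Rightarrow> 's" where
  "seq_state t \<pi> i = (t # map snd \<pi>) ! i"

definition seq_weight :: "(rat \<times> 's) list \<Rightarrow> rat" where
  "seq_weight \<pi> = sum_list (map fst \<pi>)"

definition branching_sim :: "('s, 'p) wks \<Rightarrow> real \<Rightarrow> ('s \<times> 's) set \<Rightarrow> bool" where
  "branching_sim K \<epsilon> R \<longleftrightarrow>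
     R \<subseteq> states K \<times> states K \<and>
     (\<forall>(s, t)\<in>R.
        label K s = label K t \<and>
        (\<forall>w s'. (s, w, s') \<in> trans K \<longrightarrow>
          (\<exists>\<pi>. trans_seq K t \<pi> \<and>
               real_of_rat (seq_weight \<pi>)
                 \<in> {real_of_rat w * (1 - \<epsilon>) .. real_of_rat w * (1 + \<epsilon>)} \<and>
               (s', seq_state t \<pi> (length \<pi>)) \<in> R \<and>
               (\<forall>i<length \<pi>. (s, seq_state t \<pi> i) \<in> R))))"

definition branching_simulated :: "('s, 'p) wks \<Rightarrow> real \<Rightarrow> 's \<Rightarrow> 's \<Rightarrow> bool" where
  "branching_simulated K \<epsilon> s t \<longleftrightarrow> (\<exists>R. branching_sim K \<epsilon> R \<and> (s, t) \<in> R)"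

text \<open>
  \<open>rel_dev v w\<close> is \<open>\<bar>v / w - 1\<bar>\<close>.  Transitions may have weight \<open>w = 0\<close>, where we read
  \<open>v / 0\<close> as \<open>\<infinity>\<close> for \<open>v > 0\<close> and \<open>0 / 0\<close> as \<open>1\<close>: a step of weight 0 is matched
  exactly by sequences of weight 0, as for the interval \<open>[w(1 - \<epsilon>), w(1 + \<epsilon>)] = {0}\<close>.
  (The total division of HOL would give \<open>\<bar>v / 0 - 1\<bar> = 1\<close> for every \<open>v\<close>.)
\<close>

definition rel_dev :: "rat \<Rightarrow> rat \<Rightarrow> ennreal" where
  "rel_dev v w =
     (if w = 0 then (if v = 0 then 0 else \<infinity>)
      else ennreal \<bar>real_of_rat v / real_of_rat w - 1\<bar>)"

text \<open>
  Functions on \<open>S \<times> S\<close> are represented by functions on the whole type that are 0 outside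
  \<open>S \<times> S\<close>; the functional below only returns such functions, so its least fixed point
  is the one in the lattice of functions \<open>S \<times> S \<Rightarrow> [0, \<infinity>]\<close>.  In \<^typ>\<open>ennreal\<close> the
  supremum of the empty set is 0.
\<close>

definition dist_fun :: "('s, 'p) wks \<Rightarrow> ('s \<Rightarrow> 's \<Rightarrow> ennreal) \<Rightarrow> 's \<Rightarrow> 's \<Rightarrow> ennreal" where
  "dist_fun K d s t =
     (if s \<notin> states K \<or> t \<notin> states K then 0
      else if label K s \<noteq> label K t then \<infinity>
      else (SUP (w, s') \<in> {(w, s'). (s, w, s') \<in> trans K}.
             INF \<pi> \<in> {\<pi>. trans_seq K t \<pi>}.
               max (rel_dev (seq_weight \<pi>) w)
                (max (d s' (seq_state t \<pi> (length \<pi>)))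
                     (SUP i \<in> {1..<length \<pi>}. d s (seq_state t \<pi> i)))))"

definition branching_dist :: "('s, 'p) wks \<Rightarrow> 's \<Rightarrow> 's \<Rightarrow> ennreal" where
  "branching_dist K = lfp (dist_fun K)"

lemma mono_dist_fun: "mono (dist_fun K)"
proof (intro monoI le_funI)
  fix d e :: "'a \<Rightarrow> 'a \<Rightarrow> ennreal" and s t
  assume "d \<le> e"
  then have le: "d x y \<le> e x y" for x y
    by (simp add: le_fun_def)
  show "dist_fun K d s t \<le> dist_fun K e s t"
    unfolding dist_fun_def
    by (auto intro!: SUP_mono' INF_mono' max.mono le split: prod.split)
qed

lemma branching_dist_unfold: "branching_dist K = dist_fun K (branching_dist K)"
  unfolding branching_dist_def by (rule lfp_unfold [OF mono_dist_fun])

end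

theory Submission
  imports Defs
begin

text \<open>
  A simulation \<open>R\<close> yields the pre-fixed point that is \<open>\<epsilon>\<close> on \<open>R\<close> and \<open>\<infinity>\<close> off \<open>R\<close>, so the
  least fixed point is at most \<open>\<epsilon>\<close> on \<open>R\<close>.  Conversely \<open>{(s, t). d s t \<le> \<epsilon>}\<close> is a simulation
  once the infimum over transition sequences is known to be attained.  It is: accumulated weights
  are nonnegative multiples of \<open>1 / N\<close> for a common denominator \<open>N\<close> of the finitely many
  transition weights, and \<open>d\<close> takes finitely many values on \<open>S \<times> S\<close>, so only finitely many
  values of the minimised expression lie below any finite bound.
\<close>

section \<open>Discreteness of rational weights and attainment of infima\<close>

lemma finite_rats_common_denominator:
  fixes W :: "rat set"
  assumes "finite W"
  obtains N :: int where "0 < N" and "\<And>w. w \<in> W \<Longrightarrow> of_int N * w \<in> \<int>"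
proof -
  from assms have "\<exists>N::int. 0 < N \<and> (\<forall>w\<in>W. of_int N * w \<in> \<int>)"
  proof induction
    case empty
    then show ?case by (auto intro: exI[of _ 1])
  next
    case (insert x W)
    then obtain N :: int where N: "0 < N" "\<forall>w\<in>W. of_int N * w \<in> \<int>" by blast
    obtain a b :: int where x: "x = of_int a / of_int b" "0 < b"
      by (metis Fract_of_int_quotient Rat_cases)
    \<comment> \<open>The factor \<open>b\<close> turns \<open>x\<close> into the integer
      \<open>a\<close>, while \<open>N\<close> already clears the elements of
      \<open>W\<close>.\<close>
    have "of_int (N * b) * x \<in> \<int>"
      using x by simp
    moreover have "of_int (N * b) * w \<in> \<int>" if "w \<in> W" for w
    proof -
      have "of_int b * (of_int N * w) \<in> \<int>"
        by (rule Ints_mult[OF Ints_of_int]) (use N that in blast)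
      then show ?thesis by (simp add: ac_simps)
    qed
    ultimately show ?case
      using N x by (intro exI[of _ "N * b"]) auto
  qed
  then show ?thesis using that by blast
qed

text \<open>Such \<open>v\<close> are the fractions \<open>k / N\<close> with integer
  \<open>k\<close> between 0 and the floor of \<open>N * c\<close>.\<close>

lemma finite_bounded_multiples:
  fixes N :: int and c :: rat
  assumes "0 < N"
  shows "finite {v. of_int N * v \<in> \<int> \<and> 0 \<le> v \<and> v \<le> c}"
proof (rule finite_subset)
  show "finite ((\<lambda>k. of_int k / of_int N :: rat) ` {0..\<lfloor>of_int N * c\<rfloor>})" by simp
  show "{v. of_int N * v \<in> \<int> \<and> 0 \<le> v \<and> v \<le> c}
      \<subseteq> (\<lambda>k. of_int k / of_int N) ` {0..\<lfloor>of_int N * c\<rfloor>}"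
  proof clarify
    fix v :: rat assume v: "of_int N * v \<in> \<int>" "0 \<le> v" "v \<le> c"
    from v(1) obtain k :: int where k: "of_int N * v = of_int k" by (auto elim: Ints_cases)
    have "0 \<le> (of_int k :: rat)" using v assms by (simp flip: k)
    moreover have "(of_int k :: rat) \<le> of_int N * c"
      using v assms by (simp flip: k)
    ultimately have "k \<in> {0..\<lfloor>of_int N * c\<rfloor>}" by (simp add: le_floor_iff)
    moreover have "v = of_int k / of_int N" using k assms by (simp add: field_simps)
    ultimately show "v \<in> (\<lambda>k. of_int k / of_int N) ` {0..\<lfloor>of_int N * c\<rfloor>}" by blast
  qed
qed

text \<open>If all values exceeded \<open>c\<close>, the least of \<open>b\<close> and the finitely
  many values up to \<open>b\<close> would be a lower bound above \<open>c\<close>. The gap between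
  \<open>c\<close> and \<open>b\<close> excludes values that decrease to \<open>c\<close> without
  reaching it.\<close>

lemma INF_attained_of_finite_below:
  fixes f :: "'a \<Rightarrow> 'b::complete_linorder"
  assumes inf: "(INF x\<in>A. f x) \<le> c" and "c < b" and fin: "finite (f ` A \<inter> {..b})"
  shows "\<exists>x\<in>A. f x \<le> c"
proof (rule ccontr)
  assume "\<not> ?thesis"
  then have gt: "c < f x" if "x \<in> A" for x using that by force
  let ?m = "Min (insert b (f ` A \<inter> {..b}))"
  have "?m \<le> f x" if "x \<in> A" for x
  proof (cases "f x \<le> b")
    case True
    then show ?thesis using that fin by (intro Min_le) auto
  next
    case False
    moreover have "?m \<le> b" using fin by (intro Min_le) auto
    ultimately show ?thesis by simp
  qed
  then have "?m \<le> (INF x\<in>A. f x)" by (auto intro: INF_greatest)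
  moreover have "c < ?m" using fin gt \<open>c < b\<close> by auto
  ultimately show False using inf by simp
qed

text \<open>In a linear order a finite nonempty supremum is a maximum; \<open>bot\<close> covers
  empty \<open>A\<close>. This confines the supremum over intermediate states to finitely many
  values.\<close>

lemma SUP_finite_bot_or_mem:
  fixes f :: "'a \<Rightarrow> 'b::complete_linorder"
  assumes "finite A"
  shows "(SUP x\<in>A. f x) \<in> insert bot (f ` A)"
  using assms
proof induction
  case (insert x A)
  then show ?case by (auto simp: sup_max max_def)
qed simp

text \<open>For \<open>w = 0\<close> the interval is \<open>{0}\<close> and \<open>rel_dev\<close>
  is 0 or \<infinity>, so both sides say \<open>v = 0\<close>. For \<open>w > 0\<close> the
  deviation bound is multiplied by \<open>w\<close>.\<close>

lemma rel_dev_le_iff: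
  assumes "0 \<le> w" and "0 \<le> \<epsilon>"
  shows "rel_dev v w \<le> ennreal \<epsilon> \<longleftrightarrow>
    real_of_rat v \<in> {real_of_rat w * (1 - \<epsilon>) .. real_of_rat w * (1 + \<epsilon>)}"
proof (cases "w = 0")
  case True
  then show ?thesis by (auto simp: rel_dev_def top_unique)
next
  case False
  then have "0 < real_of_rat w" using assms by simp
  then show ?thesis using False assms
    by (auto simp: rel_dev_def abs_le_iff field_simps)
qed

section \<open>States and accumulated weights of transition sequences\<close>

lemma trans_seq_states:
  assumes "weighted_kripke_structure K" "trans_seq K t \<pi>" "t \<in> states K" "i \<le> length \<pi>"
  shows "seq_state t \<pi> i \<in> states K"
  using assms(2-)
proof (induction \<pi> arbitrary: t i)
  case Nil
  then show ?case by (simp add: seq_state_def)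
next
  case (Cons a \<pi>)
  obtain v t' where a: "a = (v, t')" by force
  have t': "t' \<in> states K" "trans_seq K t' \<pi>"
    using Cons.prems assms(1) by (auto simp: a weighted_kripke_structure_def)
  show ?case
  proof (cases i)
    case 0
    then show ?thesis using Cons.prems by (simp add: seq_state_def)
  next
    case (Suc j)
    then show ?thesis using Cons.IH[OF t'(2,1), of j] Cons.prems
      by (simp add: seq_state_def a)
  qed
qed

lemma seq_weight_nonneg:
  assumes "weighted_kripke_structure K" "trans_seq K t \<pi>"
  shows "0 \<le> seq_weight \<pi>"
  using assms(2)
proof (induction \<pi> arbitrary: t)
  case (Cons a \<pi>)
  then show ?case using assms(1)
    by (cases a) (fastforce simp: seq_weight_def weighted_kripke_structure_def)
qed (simp add: seq_weight_def)

lemma seq_weight_multiple: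
  assumes "\<And>s w s'. (s, w, s') \<in> trans K \<Longrightarrow> of_int N * w \<in> \<int>" and "trans_seq K t \<pi>"
  shows "of_int N * seq_weight \<pi> \<in> \<int>"
  using assms(2)
proof (induction \<pi> arbitrary: t)
  case (Cons a \<pi>)
  obtain v t' where a: "a = (v, t')" by force
  have "of_int N * v + of_int N * seq_weight \<pi> \<in> \<int>"
    using Cons assms(1) by (intro Ints_add) (auto simp: a)
  then show ?case by (simp add: a seq_weight_def distrib_left)
qed (simp add: seq_weight_def)

text \<open>Deviation at most \<open>b\<close> bounds the accumulated weight by
  \<open>w * (1 + b)\<close>, and only finitely many nonnegative multiples of \<open>1 / N\<close>
  lie below that, although the sequences may be infinitely many.\<close>

lemma finite_rel_dev_below:
  assumes K: "weighted_kripke_structure K" and "0 \<le> w" and "0 \<le> b"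
  shows "finite ((\<lambda>\<pi>. rel_dev (seq_weight \<pi>) w) ` {\<pi>. trans_seq K t \<pi>} \<inter> {..ennreal b})"
proof -
  have "finite ((\<lambda>(s, w, s'). w) ` trans K)"
    using K by (simp add: weighted_kripke_structure_def)
  then obtain N :: int where "0 < N"
    and N: "\<And>w. w \<in> (\<lambda>(s, w, s'). w) ` trans K \<Longrightarrow> of_int N * w \<in> \<int>"
    by (rule finite_rats_common_denominator) blast
  \<comment> \<open>Weights are rational but \<open>b\<close> is real, so the bound is rounded up to
    a rational.\<close>
  obtain c :: rat where c: "real_of_rat w * (1 + b) < real_of_rat c"
    by (meson gt_ex of_rat_dense order_less_trans)
  let ?V = "{v. of_int N * v \<in> \<int> \<and> 0 \<le> v \<and> v \<le> c}"
  have "(\<lambda>\<pi>. rel_dev (seq_weight \<pi>) w) ` {\<pi>. trans_seq K t \<pi>} \<inter> {..ennreal b}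
      \<subseteq> (\<lambda>v. rel_dev v w) ` ?V"
  proof clarify
    fix \<pi> assume \<pi>: "trans_seq K t \<pi>" and le: "rel_dev (seq_weight \<pi>) w \<le> ennreal b"
    have "real_of_rat (seq_weight \<pi>) \<le> real_of_rat c"
      using le c assms by (auto simp: rel_dev_le_iff)
    then have "seq_weight \<pi> \<le> c" by (simp add: of_rat_less_eq)
    moreover have "of_int N * seq_weight \<pi> \<in> \<int>"
      by (rule seq_weight_multiple[OF _ \<pi>]) (use N in force)
    ultimately have "seq_weight \<pi> \<in> ?V"
      using seq_weight_nonneg[OF K \<pi>] by simp
    then show "rel_dev (seq_weight \<pi>) w \<in> (\<lambda>v. rel_dev v w) ` ?V" by blast
  qed
  then show ?thesis
    using finite_bounded_multiples[OF \<open>0 < N\<close>] by (meson finite_imageI finite_subset)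
qed

text \<open>For any \<open>d\<close>, finiteness of \<open>states K\<close> leaves finitely many
  values on pairs of states. A maximum equals one of its arguments, so each value of the minimised
  expression is a deviation or comes from this finite set.\<close>

lemma matching_seq_attained:
  fixes d :: "'s \<Rightarrow> 's \<Rightarrow> ennreal"
  assumes K: "weighted_kripke_structure K" and t: "t \<in> states K"
    and tr: "(s, w, s') \<in> trans K" and "0 \<le> \<epsilon>"
    and inf: "(INF \<pi> \<in> {\<pi>. trans_seq K t \<pi>}.
               max (rel_dev (seq_weight \<pi>) w)
                (max (d s' (seq_state t \<pi> (length \<pi>)))
                     (SUP i \<in> {1..<length \<pi>}. d s (seq_state t \<pi> i)))) \<le> ennreal \<epsilon>"
  shows "\<exists>\<pi>. trans_seq K t \<pi> \<and> rel_dev (seq_weight \<pi>) w \<le> ennreal \<epsilon> \<and>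
           d s' (seq_state t \<pi> (length \<pi>)) \<le> ennreal \<epsilon> \<and>
           (\<forall>i\<in>{1..<length \<pi>}. d s (seq_state t \<pi> i) \<le> ennreal \<epsilon>)"
proof -
  let ?A = "{\<pi>. trans_seq K t \<pi>}"
  define g where "g \<pi> = rel_dev (seq_weight \<pi>) w" for \<pi> :: "(rat \<times> 's) list"
  define e where "e \<pi> = max (d s' (seq_state t \<pi> (length \<pi>)))
    (SUP i \<in> {1..<length \<pi>}. d s (seq_state t \<pi> i))" for \<pi>
  \<comment> \<open>Any finite bound above \<epsilon> would serve as the gap for
    \<open>INF_attained_of_finite_below\<close>.\<close>
  let ?b = "ennreal (\<epsilon> + 1)"
  \<comment> \<open>The extra 0 is the supremum for sequences without intermediate states.\<close>
  let ?D = "insert 0 ((\<lambda>(x, y). d x y) ` (states K \<times> states K))"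
  have st: "s \<in> states K" "s' \<in> states K" "0 \<le> w"
    using K tr by (auto simp: weighted_kripke_structure_def)
  have e: "e \<pi> \<in> ?D" if "\<pi> \<in> ?A" for \<pi>
  proof -
    have "(SUP i \<in> {1..<length \<pi>}. d s (seq_state t \<pi> i))
        \<in> insert bot ((\<lambda>i. d s (seq_state t \<pi> i)) ` {1..<length \<pi>})"
      by (rule SUP_finite_bot_or_mem) simp
    moreover have D: "d x (seq_state t \<pi> i) \<in> ?D" if "x \<in> states K" "i \<le> length \<pi>" for x i
      using trans_seq_states[OF K _ t that(2)] \<open>\<pi> \<in> ?A\<close> that(1) by force
    moreover have "insert bot ((\<lambda>i. d s (seq_state t \<pi> i)) ` {1..<length \<pi>}) \<subseteq> ?D"
      and "d s' (seq_state t \<pi> (length \<pi>)) \<in> ?D"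
      using D[OF st(1)] D[OF st(2), of "length \<pi>"] by (simp_all add: bot_ennreal image_subset_iff)
    ultimately have "(SUP i \<in> {1..<length \<pi>}. d s (seq_state t \<pi> i)) \<in> ?D"
      "d s' (seq_state t \<pi> (length \<pi>)) \<in> ?D"
      by blast+
    then show ?thesis unfolding e_def max_def by simp
  qed
  have "(\<lambda>\<pi>. max (g \<pi>) (e \<pi>)) ` ?A \<inter> {..?b} \<subseteq> (g ` ?A \<inter> {..?b}) \<union> ?D"
    using e by (auto simp: max_def)
  moreover have "finite ((g ` ?A \<inter> {..?b}) \<union> ?D)"
    using finite_rel_dev_below[OF K \<open>0 \<le> w\<close>, of "\<epsilon> + 1" t] K \<open>0 \<le> \<epsilon>\<close>
    by (simp add: g_def weighted_kripke_structure_def)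
  ultimately have "finite ((\<lambda>\<pi>. max (g \<pi>) (e \<pi>)) ` ?A \<inter> {..?b})"
    by (rule finite_subset)
  moreover have "ennreal \<epsilon> < ?b"
    using \<open>0 \<le> \<epsilon>\<close> by (intro ennreal_lessI) auto
  ultimately have "\<exists>\<pi>\<in>?A. max (g \<pi>) (e \<pi>) \<le> ennreal \<epsilon>"
    using inf by (intro INF_attained_of_finite_below) (auto simp: g_def e_def)
  then show ?thesis
    by (auto simp: g_def e_def SUP_le_iff)
qed

section \<open>The two directions of the equivalence\<close>

text \<open>The restriction to states keeps out the pairs off \<open>states K\<close>, whose
  distance is 0 by convention. Attained infima supply the matching sequences.\<close>

lemma branching_sim_dist_le:
  assumes K: "weighted_kripke_structure K" and "0 \<le> \<epsilon>"
  shows "branching_sim K \<epsilon>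
    {(s, t). s \<in> states K \<and> t \<in> states K \<and> branching_dist K s t \<le> ennreal \<epsilon>}"
    (is "branching_sim K \<epsilon> ?R")
  unfolding branching_sim_def
proof (intro conjI ballI, force, clarify, intro conjI allI impI)
  fix s t assume s: "s \<in> states K" and t: "t \<in> states K"
    and d: "branching_dist K s t \<le> ennreal \<epsilon>"
  then have F: "dist_fun K (branching_dist K) s t \<le> ennreal \<epsilon>"
    by (subst (asm) branching_dist_unfold)
  then show lab: "label K s = label K t"
    using s t by (auto simp: dist_fun_def top_unique split: if_splits)
  fix w s' assume tr: "(s, w, s') \<in> trans K"
  then have s': "s' \<in> states K" "0 \<le> w"
    using K by (auto simp: weighted_kripke_structure_def)
  have "(INF \<pi> \<in> {\<pi>. trans_seq K t \<pi>}.
               max (rel_dev (seq_weight \<pi>) w)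
                (max (branching_dist K s' (seq_state t \<pi> (length \<pi>)))
                     (SUP i \<in> {1..<length \<pi>}. branching_dist K s (seq_state t \<pi> i)))) \<le> ennreal \<epsilon>"
    using F s t lab tr by (auto simp: dist_fun_def SUP_le_iff)
  from matching_seq_attained[OF K t tr \<open>0 \<le> \<epsilon>\<close> this]
  obtain \<pi> where \<pi>: "trans_seq K t \<pi>" "rel_dev (seq_weight \<pi>) w \<le> ennreal \<epsilon>"
      "branching_dist K s' (seq_state t \<pi> (length \<pi>)) \<le> ennreal \<epsilon>"
      "\<forall>i\<in>{1..<length \<pi>}. branching_dist K s (seq_state t \<pi> i) \<le> ennreal \<epsilon>"
    by blast
  \<comment> \<open>Simulations also constrain index 0, which the functional omits. The state there
    is \<open>t\<close>, so \<open>d\<close> settles that case.\<close>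
  have "branching_dist K s (seq_state t \<pi> i) \<le> ennreal \<epsilon>" if "i < length \<pi>" for i
    using that \<pi>(4) d by (cases "i = 0") (simp add: seq_state_def, simp)
  then show "\<exists>\<pi>. trans_seq K t \<pi> \<and>
      real_of_rat (seq_weight \<pi>) \<in> {real_of_rat w * (1 - \<epsilon>)..real_of_rat w * (1 + \<epsilon>)} \<and>
      (s', seq_state t \<pi> (length \<pi>)) \<in> ?R \<and>
      (\<forall>i<length \<pi>. (s, seq_state t \<pi> i) \<in> ?R)"
    using \<pi> s s' trans_seq_states[OF K \<pi>(1) t] rel_dev_le_iff[OF \<open>0 \<le> w\<close> \<open>0 \<le> \<epsilon>\<close>]
    by (intro exI[of _ \<pi>]) auto
qed

lemma branching_dist_le_of_sim:
  assumes K: "weighted_kripke_structure K" and "0 \<le> \<epsilon>"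
    and R: "branching_sim K \<epsilon> R" and "(s, t) \<in> R"
  shows "branching_dist K s t \<le> ennreal \<epsilon>"
proof -
  \<comment> \<open>The value 0 off the states agrees with \<open>dist_fun\<close>, and \<infinity>
    makes the inequality trivial for pairs of states outside \<open>R\<close>. Only pairs in
    \<open>R\<close> need the simulation property.\<close>
  define d where "d x y = (if x \<notin> states K \<or> y \<notin> states K then 0
    else if (x, y) \<in> R then ennreal \<epsilon> else \<infinity>)" for x y
  have dR: "d x y \<le> ennreal \<epsilon>" if "(x, y) \<in> R" for x y
    using that by (simp add: d_def)
  have "dist_fun K d x y \<le> d x y" for x y
  proof (cases "(x, y) \<in> R")
    case False
    then show ?thesis by (simp add: d_def dist_fun_def)
  next
    case True
    then have xy: "x \<in> states K" "y \<in> states K" and lab: "label K x = label K y"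
      using R by (auto simp: branching_sim_def)
    have "(INF \<pi> \<in> {\<pi>. trans_seq K y \<pi>}.
               max (rel_dev (seq_weight \<pi>) w)
                (max (d x' (seq_state y \<pi> (length \<pi>)))
                     (SUP i \<in> {1..<length \<pi>}. d x (seq_state y \<pi> i)))) \<le> ennreal \<epsilon>"
      if tr: "(x, w, x') \<in> trans K" for w x'
    proof -
      have "0 \<le> w" using tr K by (auto simp: weighted_kripke_structure_def)
      obtain \<pi> where \<pi>: "trans_seq K y \<pi>"
        "real_of_rat (seq_weight \<pi>) \<in> {real_of_rat w * (1 - \<epsilon>)..real_of_rat w * (1 + \<epsilon>)}"
        "(x', seq_state y \<pi> (length \<pi>)) \<in> R" "\<forall>i<length \<pi>. (x, seq_state y \<pi> i) \<in> R"
        using R True tr unfolding branching_sim_def by blast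
      have "rel_dev (seq_weight \<pi>) w \<le> ennreal \<epsilon>"
        using \<pi>(2) rel_dev_le_iff[OF \<open>0 \<le> w\<close> \<open>0 \<le> \<epsilon>\<close>] by blast
      \<comment> \<open>A single matching sequence already bounds the infimum, so attainment is
        irrelevant in this direction.\<close>
      then show ?thesis
        using \<pi> by (intro INF_lower2[of \<pi>]) (auto intro!: dR SUP_least)
    qed
    then have "dist_fun K d x y \<le> ennreal \<epsilon>"
      using xy lab by (auto simp: dist_fun_def intro!: SUP_least)
    then show ?thesis using True xy by (simp add: d_def)
  qed
  then have "branching_dist K \<le> d"
    unfolding branching_dist_def by (intro lfp_lowerbound le_funI)
  then show ?thesis
    using dR[OF \<open>(s, t) \<in> R\<close>] by (meson le_funD order_trans)
qed

theorem theorem3: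
  fixes K :: "('s, 'p) wks" and s t :: 's and \<epsilon> :: real
  assumes "weighted_kripke_structure K"
    and "s \<in> states K" and "t \<in> states K"
    and "0 \<le> \<epsilon>"
  shows "branching_dist K s t \<le> ennreal \<epsilon> \<longleftrightarrow> branching_simulated K \<epsilon> s t"
  using branching_sim_dist_le[OF assms(1,4)] branching_dist_le_of_sim[OF assms(1,4)] assms(2,3)
  unfolding branching_simulated_def by blast

end
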